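(* Let $N\ge1$, let $\mathfrak q=(\mathfrak q_{ij})_{i,j=1}^{2N}$ be the matrix with entries $$\mathfrak q_{ij}=\int_0^1x^{i+j-2}(1-x)\,dx=[(i+j)(i+j-1)]^{-1},$$ and let $\mathfrak Q=\mathfrak q^{-1}$. Then the matrix element $\mathfrak Q_{11}$ equals $2N(2N+1)$.
   Context: No further notation is needed. *)

theory Defs
  imports "HOL-Analysis.Henstock_Kurzweil_Integration" "Jordan_Normal_Form.Matrix"
begin

text \<open>The indices \<open>i\<close> and \<open>j\<close> are one-based, so the truncated subtraction in the exponent is exact.\<close>

definition q_entry :: "nat \<Rightarrow> nat \<Rightarrow> real" where
  "q_entry i j = integral {0..1} (\<lambda>x. x ^ (i + j - 2) * (1 - x))"

text \<open>Matrices from \<^theory>\<open>Jordan_Normal_Form.Matrix\<close> are zero-based, hence the shift;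
  the entry usually written \<open>(1,1)\<close> is the one at position \<open>(0,0)\<close>.\<close>

definition q_mat :: "nat \<Rightarrow> real mat" where
  "q_mat N = Matrix.mat (2 * N) (2 * N) (\<lambda>(i, j). q_entry (Suc i) (Suc j))"

end

theory Submission
  imports Defs "Jordan_Normal_Form.Determinant" "HOL-Computational_Algebra.Polynomial"
  "HOL-Analysis.Equivalence_Lebesgue_Henstock_Integration"
begin

text \<open>
  Put \<open>n = 2N\<close>; the parity of \<open>n\<close> plays no role. The matrix \<open>q\<close> is the Gram matrix of the monomials
  \<open>1, x, \<dots>, x\<^bsup>n-1\<^esup>\<close> for the inner product with weight \<open>1 - x\<close> on \<open>[0, 1]\<close>. A kernel vector \<open>v\<close> is
  therefore the coefficient vector of a polynomial of norm zero, which vanishes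
  (\<open>q_entry_kernel_trivial\<close>); so \<open>q\<close> is invertible.

  The entry of the inverse in the upper left corner is the first coordinate of the solution \<open>c\<close> of
  \<open>q c = e\<^sub>1\<close>. In zero-based indices this system reads
  \<open>(\<Sum>k<n. c\<^sub>k / ((i+k+1)(i+k+2))) = (if i = 0 then 1 else 0)\<close> for \<open>i < n\<close>. With \<open>m = n - 1\<close>, its solution is
  \<open>c\<^sub>k = (-1)\<^sup>k (m choose k) (k+2)(k+3)\<cdots>(k+m+2) / m!\<close>, the coefficients of a Jacobi polynomial
  on \<open>[0, 1]\<close>. Indeed, for \<open>1 \<le> i \<le> m\<close> the denominator \<open>(k+i+1)(k+i+2)\<close> cancels two factors of the
  product, which leaves a polynomial in \<open>k\<close> of degree \<open>m - 1\<close>, and an alternating binomial sum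
  of order \<open>m\<close> (an \<open>m\<close>-th finite difference) annihilates it. For \<open>i = 0\<close> only the factor \<open>k + 2\<close>
  cancels, and the remaining quotient by \<open>k + 1\<close> is summed by splitting off its
  residue at \<open>k = -1\<close> (\<open>alternating_binomial_sum_poly_div_Suc\<close>). Finally
  \<open>c\<^sub>0 = (m+2)! / m! = n (n+1)\<close>.
\<close>

section \<open>The entries\<close>

lemma q_entry_Suc:
  "q_entry (Suc i) (Suc j) = 1 / ((real i + real j + 1) * (real i + real j + 2))"
proof -
  define m where "m = i + j"
  let ?F = "\<lambda>x::real. x ^ Suc m / real (Suc m) - x ^ Suc (Suc m) / real (Suc (Suc m))"
  have "((\<lambda>x. x ^ m * (1 - x)) has_integral (?F 1 - ?F 0)) {0..1}"
  proof (rule fundamental_theorem_of_calculus)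
    fix x :: real
    have "(?F has_real_derivative x ^ m * (1 - x)) (at x within {0..1})"
      by (rule derivative_eq_intros refl | simp)+ (simp add: field_simps)
    thus "(?F has_vector_derivative x ^ m * (1 - x)) (at x within {0..1})"
      by (simp add: has_real_derivative_iff_has_vector_derivative)
  qed simp
  moreover have "?F 1 - ?F 0 = 1 / ((real m + 1) * (real m + 2))"
    by (simp add: field_simps)
  ultimately show ?thesis
    by (auto simp: q_entry_def m_def intro!: integral_unique)
qed

section \<open>Invertibility\<close>

text \<open>
  With \<open>p(x) = \<Sum>j<n. v\<^sub>j x\<^sup>j\<close>, the quadratic form of the matrix at \<open>v\<close> is the integral of
  \<open>p(x)\<^sup>2 (1 - x)\<close> over \<open>[0, 1]\<close>.
\<close>

lemma q_entry_kernel_trivial: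
  fixes v :: "nat \<Rightarrow> real"
  assumes "\<And>i. i < n \<Longrightarrow> (\<Sum>j<n. q_entry (Suc i) (Suc j) * v j) = 0" and "k < n"
  shows "v k = 0"
proof -
  define p where "p = (\<Sum>j<n. monom (v j) j)"
  have poly_p: "poly p x = (\<Sum>j<n. v j * x ^ j)" for x
    by (simp add: p_def poly_sum poly_monom)
  let ?w = "\<lambda>x. (poly p x)\<^sup>2 * (1 - x)"
  have moment: "((\<lambda>x::real. x ^ (i + j) * (1 - x)) has_integral q_entry (Suc i) (Suc j)) {0..1}" for i j
    unfolding q_entry_def
    by (simp, intro integrable_integral integrable_continuous_real continuous_intros)
  have "((\<lambda>x. \<Sum>i<n. \<Sum>j<n. (v i * v j) * (x ^ (i + j) * (1 - x))) has_integral
          (\<Sum>i<n. \<Sum>j<n. (v i * v j) * q_entry (Suc i) (Suc j))) {0..1}"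
    by (intro has_integral_sum has_integral_mult_right moment) auto
  moreover have "(\<Sum>i<n. \<Sum>j<n. (v i * v j) * (x ^ (i + j) * (1 - x))) = ?w x" for x
    unfolding poly_p power2_eq_square sum_product unfolding sum_distrib_right
    by (intro sum.cong refl) (simp add: power_add mult_ac)
  moreover have "(\<Sum>i<n. \<Sum>j<n. (v i * v j) * q_entry (Suc i) (Suc j))
      = (\<Sum>i<n. v i * (\<Sum>j<n. q_entry (Suc i) (Suc j) * v j))"
    by (simp add: sum_distrib_left mult_ac)
  moreover have "\<dots> = 0"
    using assms(1) by simp
  ultimately have int0: "(?w has_integral 0) (cbox 0 1)"
    by simp
  have "poly p x = 0" if "x \<in> {0<..<1}" for x :: real
  proof -
    have "?w x = 0"
      by (rule has_integral_0_cbox_imp_0[OF _ _ int0])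
        (use that in \<open>auto intro!: continuous_intros\<close>)
    with that show ?thesis by simp
  qed
  hence "{0<..<1} \<subseteq> {x::real. poly p x = 0}"
    by blast
  hence "infinite {x::real. poly p x = 0}"
    by (rule infinite_super) (simp add: infinite_Ioo)
  hence "p = 0"
    using poly_roots_finite by blast
  moreover have "coeff p k = v k"
    using \<open>k < n\<close> by (simp add: p_def coeff_sum sum.delta)
  ultimately show ?thesis by simp
qed

lemma invertible_q_mat: "invertible_mat (q_mat N)"
proof -
  have carr: "q_mat N \<in> carrier_mat (2 * N) (2 * N)"
    by (simp add: q_mat_def)
  have "Determinant.det (q_mat N) \<noteq> 0"
  proof
    assume "Determinant.det (q_mat N) = 0"
    then obtain v where v: "v \<in> carrier_vec (2 * N)" "v \<noteq> 0\<^sub>v (2 * N)" 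
      "q_mat N *\<^sub>v v = 0\<^sub>v (2 * N)"
      using det_0_iff_vec_prod_zero_field[OF carr] by blast
    have row: "(\<Sum>j<2 * N. q_entry (Suc i) (Suc j) * vec_index v j) = 0" if "i < 2 * N" for i
    proof -
      have "vec_index (q_mat N *\<^sub>v v) i = (\<Sum>j<2 * N. q_entry (Suc i) (Suc j) * vec_index v j)"
        using that v(1) by (simp add: q_mat_def scalar_prod_def atLeast0LessThan)
      thus ?thesis using v(3) that by simp
    qed
    have "v = 0\<^sub>v (2 * N)"
      by (rule eq_vecI) (use v(1) q_entry_kernel_trivial[OF row] in auto)
    with v(2) show False ..
  qed
  from det_non_zero_imp_unit[OF carr this, of "()"]
  obtain B where "B \<in> carrier_mat (2 * N) (2 * N)"
    "B * q_mat N = 1\<^sub>m (2 * N)" "q_mat N * B = 1\<^sub>m (2 * N)"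
    by (auto simp: Units_def ring_mat_def)
  thus ?thesis
    using carr by (auto simp: invertible_mat_def inverts_mat_def)
qed

section \<open>Alternating binomial sums\<close>

text \<open>
  The sum is, up to sign, the \<open>m\<close>-th forward difference of \<open>p\<close> at \<open>0\<close>. The induction writes
  \<open>p(x) = c + x q(x)\<close> and absorbs the factor \<open>k\<close> into the binomial coefficient, which lowers the
  order and the degree by one and shifts the argument of \<open>q\<close>.
\<close>

lemma alternating_binomial_sum_poly_eq_0:
  fixes p :: "real poly"
  assumes "degree p < m"
  shows "(\<Sum>k\<le>m. (-1) ^ k * real (m choose k) * poly p (real k)) = 0"
  using assms
proof (induction m arbitrary: p)
  case (Suc m)
  obtain c q where p: "p = pCons c q"
    by (cases p)
  have "(\<Sum>k\<le>Suc m. (-1) ^ k * real (Suc m choose k) * poly p (real k))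
      = c * (\<Sum>k\<le>Suc m. (-1) ^ k * real (Suc m choose k))
        + (\<Sum>k\<le>Suc m. (-1) ^ k * (real k * real (Suc m choose k)) * poly q (real k))"
    by (simp add: p sum_distrib_left sum.distrib algebra_simps del: sum.atMost_Suc binomial_Suc_Suc)
  also have "(\<Sum>k\<le>Suc m. (-1) ^ k * real (Suc m choose k)) = 0"
    using choose_alternating_sum[of "Suc m", where 'a = real] by simp
  also have "(\<Sum>k\<le>Suc m. (-1) ^ k * (real k * real (Suc m choose k)) * poly q (real k))
      = (\<Sum>k\<le>m. (-1) ^ Suc k * (real (Suc k) * real (Suc m choose Suc k)) * poly q (real (Suc k)))"
    by (subst sum.atMost_Suc_shift) simp
  also have "\<dots> = - real (Suc m) *
      (\<Sum>k\<le>m. (-1) ^ k * real (m choose k) * poly (pcompose q [:1, 1:]) (real k))"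
  proof -
    have absorb: "real (Suc k) * real (Suc m choose Suc k) = real (Suc m) * real (m choose k)" for k
      using Suc_times_binomial_eq[of m k] by (metis mult.commute of_nat_mult)
    have "(-1) ^ Suc k * (real (Suc k) * real (Suc m choose Suc k)) * poly q (real (Suc k))
        = - real (Suc m) * ((-1) ^ k * real (m choose k) * poly (pcompose q [:1, 1:]) (real k))" for k
      unfolding absorb by (simp add: poly_pcompose del: of_nat_Suc) (simp add: add.commute)
    thus ?thesis
      by (simp only: sum_distrib_left)
  qed
  also have "\<dots> = 0"
  proof (cases "q = 0")
    case False
    hence "degree (pcompose q [:1, 1:]) < m"
      using Suc.prems by (simp add: p degree_pcompose)
    thus ?thesis by (simp only: Suc.IH mult_zero_right)
  qed simp
  finally show ?case by simp
qed simp

text \<open>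
  Division of \<open>p\<close> by \<open>x + 1\<close> gives the remainder \<open>p(-1)\<close> and a quotient that is zero or of degree
  below \<open>m\<close>. The quotient contributes nothing, and the remainder contributes \<open>p(-1)\<close> times the
  sum for the constant polynomial \<open>1\<close>.
\<close>

lemma alternating_binomial_sum_poly_div_Suc:
  fixes p :: "real poly"
  assumes "degree p \<le> m"
  shows "(\<Sum>k\<le>m. (-1) ^ k * real (m choose k) * (poly p (real k) / real (Suc k)))
           = poly p (-1) / real (Suc m)"
proof -
  define q where "q = synthetic_div p (-1)"
  have "[:1, 1:] * q + [:poly p (-1):] = p"
    using synthetic_div_correct'[of "-1" p] by (simp add: q_def)
  hence p: "poly p x = (x + 1) * poly q x + poly p (-1)" for x
    by (auto simp: algebra_simps dest: arg_cong[where f = "\<lambda>r. poly r x"])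
  have eq: "poly p (real k) / real (Suc k) = poly q (real k) + poly p (-1) / real (Suc k)" for k
    unfolding p[of "real k"] by (simp add: add_divide_distrib add.commute)
  have "(\<Sum>k\<le>m. (-1) ^ k * real (m choose k) * poly q (real k)) = 0"
  proof (cases "m = 0")
    \<comment> \<open>Here \<open>degree q = 0\<close> is not below \<open>m\<close>, but \<open>p\<close> is constant.\<close>
    case True
    hence "q = 0" using assms by (simp add: q_def synthetic_div_eq_0_iff)
    thus ?thesis by simp
  next
    case False
    thus ?thesis using assms
      by (intro alternating_binomial_sum_poly_eq_0) (simp add: q_def degree_synthetic_div)
  qed
  moreover have "(\<Sum>k\<le>m. (-1) ^ k * real (m choose k) / real (Suc k)) = 1 / real (Suc m)"
  proof -
    have b: "real (m choose k) / real (Suc k) = real (Suc m choose Suc k) / real (Suc m)" for k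
      using Suc_times_binomial_eq[of m k] 
      by (simp add: divide_simps mult.commute del: binomial_Suc_Suc of_nat_Suc flip: of_nat_mult)
    have "0 = (\<Sum>k\<le>Suc m. (-1) ^ k * real (Suc m choose k))"
      using choose_alternating_sum[of "Suc m", where 'a = real] by simp
    also have "\<dots> = 1 - (\<Sum>k\<le>m. (-1) ^ k * real (Suc m choose Suc k))"
      by (subst sum.atMost_Suc_shift) (simp add: sum_negf del: binomial_Suc_Suc)
    finally have "(\<Sum>k\<le>m. (-1) ^ k * real (Suc m choose Suc k)) = 1" by simp
    thus ?thesis
      by (simp only: times_divide_eq_right[symmetric] b)
        (simp only: times_divide_eq_right sum_divide_distrib[symmetric])
  qed
  moreover have "(\<Sum>k\<le>m. (-1) ^ k * real (m choose k) * (poly p (real k) / real (Suc k)))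
      = (\<Sum>k\<le>m. (-1) ^ k * real (m choose k) * poly q (real k))
        + poly p (-1) * (\<Sum>k\<le>m. (-1) ^ k * real (m choose k) / real (Suc k))"
    unfolding eq sum_distrib_left sum.distrib[symmetric]
    by (intro sum.cong refl) (simp add: ring_distribs)
  ultimately show ?thesis
    by simp
qed

section \<open>The first column of the inverse\<close>

text \<open>
  The coefficient of \<open>x\<^sup>k\<close> in the polynomial of degree \<open>m\<close> that, for the weight \<open>1 - x\<close> on \<open>[0, 1]\<close>, is
  orthogonal to \<open>x, \<dots>, x\<^sup>m\<close> and has inner product \<open>1\<close> with the constant \<open>1\<close>. Equivalently, it is a
  multiple of the Jacobi polynomial of degree \<open>m\<close> orthogonal for the weight \<open>x (1 - x)\<close>.
\<close>

definition jacobi_coeff :: "nat \<Rightarrow> nat \<Rightarrow> real" where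
  "jacobi_coeff m k = (-1) ^ k * real (m choose k) * (\<Prod>a\<in>{2..m + 2}. real k + real a) / fact m"

lemma jacobi_coeff_0: "jacobi_coeff m 0 = (real m + 1) * (real m + 2)"
proof -
  have "(\<Prod>a\<in>{2..m + 2}. real a) = fact (m + 2)"
    by (induction m) (auto simp: prod.nat_ivl_Suc' algebra_simps)
  thus ?thesis
    by (simp add: jacobi_coeff_def del: prod.cl_ivl_Suc) (simp add: algebra_simps)
qed

text \<open>
  These numbers form the first column of the inverse of the matrix of size \<open>m + 1\<close>.
\<close>

lemma q_entry_jacobi_coeff:
  assumes "i \<le> m"
  shows "(\<Sum>k\<le>m. q_entry (Suc i) (Suc k) * jacobi_coeff m k) = (if i = 0 then 1 else 0)"
proof (cases "i = 0")
  case True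
  define p where "p = (\<Prod>a\<in>{3..m + 2}. [:real a, 1:])"
  have "degree p = m"
    by (simp add: p_def degree_prod_sum_eq del: prod.cl_ivl_Suc)
  have term_eq: "q_entry (Suc i) (Suc k) * jacobi_coeff m k =
      (1 / fact m) * ((-1) ^ k * real (m choose k) * (poly p (real k) / real (Suc k)))" for k
  proof -
    have "{2..m + 2} = insert 2 {3..m + 2}" by auto
    hence "(\<Prod>a\<in>{2..m + 2}. real k + real a) = (real k + 2) * poly p (real k)"
      by (simp add: p_def poly_prod add.commute del: prod.cl_ivl_Suc)
    thus ?thesis
      by (simp add: q_entry_Suc jacobi_coeff_def True divide_simps)
  qed
  have "poly p (-1) = (\<Prod>a\<in>{3..m + 2}. real a - 1)"
    by (simp add: p_def poly_prod del: prod.cl_ivl_Suc)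
  also have "\<dots> = fact (Suc m)"
    by (induction m) (auto simp: prod.nat_ivl_Suc' algebra_simps)
  finally have "poly p (-1) = fact (Suc m)" .
  moreover have "(\<Sum>k\<le>m. q_entry (Suc i) (Suc k) * jacobi_coeff m k)
      = (1 / fact m) * (poly p (-1) / real (Suc m))"
    unfolding term_eq
    by (subst alternating_binomial_sum_poly_div_Suc[symmetric])
      (simp_all only: sum_distrib_left \<open>degree p = m\<close>)
  ultimately show ?thesis
    using True by (simp del: of_nat_Suc)
next
  case False
  \<comment> \<open>Since \<open>1 \<le> i \<le> m\<close>, both factors of the denominator occur in the product.\<close>
  define A where "A = {2..m + 2} - {i + 1, i + 2}"
  define p where "p = (\<Prod>a\<in>A. [:real a, 1:])"
  have A: "{2..m + 2} = insert (i + 1) (insert (i + 2) A)" "finite A" "i + 1 \<notin> A" "i + 2 \<notin> A"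
    using False assms by (auto simp: A_def)
  have "card {2..m + 2} = card A + 2"
    using A by simp
  hence "degree p < m"
    using A(2) by (simp add: p_def degree_prod_sum_eq del: prod.cl_ivl_Suc)
  have term_eq: "q_entry (Suc i) (Suc k) * jacobi_coeff m k =
      (1 / fact m) * ((-1) ^ k * real (m choose k) * poly p (real k))" for k
  proof -
    have pr: "(\<Prod>a\<in>{2..m + 2}. real k + real a)
        = (real i + real k + 1) * ((real i + real k + 2) * poly p (real k))"
      unfolding A(1) using A(2-4) by (simp add: p_def poly_prod algebra_simps)
    have nz: "real i + real k + 1 \<noteq> 0" "real i + real k + 2 \<noteq> 0" by linarith+
    show ?thesis
      unfolding q_entry_Suc jacobi_coeff_def pr using nz by (simp add: divide_simps)
  qed
  show ?thesis
    unfolding term_eq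
    using alternating_binomial_sum_poly_eq_0[OF \<open>degree p < m\<close>] False
    by (simp only: flip: sum_distrib_left) simp
qed

section \<open>The corner entry of the inverse\<close>

theorem theorem14:
  fixes N :: nat
  assumes "N \<ge> 1"
  shows "(\<forall>i\<in>{1..2 * N}. \<forall>j\<in>{1..2 * N}.
            q_entry i j = inverse ((real i + real j) * (real i + real j - 1))) \<and>
         invertible_mat (q_mat N) \<and>
         (\<forall>Q. inverts_mat (q_mat N) Q \<and> inverts_mat Q (q_mat N) \<longrightarrow>
            Q $$ (0, 0) = 2 * real N * (2 * real N + 1))"
proof (intro conjI ballI allI impI)
  fix i j assume "i \<in> {1..2 * N}" "j \<in> {1..2 * N}"
  then obtain i' j' where "i = Suc i'" "j = Suc j'"
    by (metis Suc_le_D One_nat_def atLeastAtMost_iff)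
  thus "q_entry i j = inverse ((real i + real j) * (real i + real j - 1))"
    by (simp add: q_entry_Suc divide_simps) (simp add: algebra_simps)
next
  show "invertible_mat (q_mat N)" by (rule invertible_q_mat)
next
  fix Q assume "inverts_mat (q_mat N) Q \<and> inverts_mat Q (q_mat N)"
  hence Q: "q_mat N * Q = 1\<^sub>m (2 * N)" "Q * q_mat N = 1\<^sub>m (dim_row Q)"
    by (auto simp: inverts_mat_def q_mat_def)
  define m where "m = 2 * N - 1"
  have m: "2 * N = Suc m" using assms by (simp add: m_def)
  have carr: "q_mat N \<in> carrier_mat (2 * N) (2 * N)"
    by (simp add: q_mat_def)
  have "dim_col Q = 2 * N"
    using arg_cong[OF Q(1), of dim_col] by simp
  moreover have "dim_row Q = 2 * N"
    using arg_cong[OF Q(2), of dim_col] by (simp add: q_mat_def)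
  ultimately have carrQ: "Q \<in> carrier_mat (2 * N) (2 * N)" by auto
  define c where "c = Matrix.vec (2 * N) (jacobi_coeff m)"
  have "q_mat N *\<^sub>v c = unit_vec (2 * N) 0"
  proof (rule eq_vecI)
    fix i assume "i < dim_vec (unit_vec (2 * N) 0 :: real Matrix.vec)"
    hence i: "i < 2 * N" by simp
    have "vec_index (q_mat N *\<^sub>v c) i = (\<Sum>k\<le>m. q_entry (Suc i) (Suc k) * jacobi_coeff m k)"
      using i by (simp add: q_mat_def c_def scalar_prod_def m atLeast0LessThan lessThan_Suc_atMost
          del: sum.atMost_Suc)
    also have "\<dots> = (if i = 0 then 1 else 0)"
      using i m by (intro q_entry_jacobi_coeff) simp
    finally show "vec_index (q_mat N *\<^sub>v c) i = vec_index (unit_vec (2 * N) 0) i"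
      using i by simp
  qed (simp add: q_mat_def)
  moreover have "c \<in> carrier_vec (2 * N)" by (simp add: c_def)
  ultimately have c_eq: "c = Q *\<^sub>v unit_vec (2 * N) 0"
    using Q(2) carr carrQ by (metis assoc_mult_mat_vec carrier_matD(1) one_mult_mat_vec)
  have "Q $$ (0, 0) = vec_index (Q *\<^sub>v unit_vec (2 * N) 0) 0"
    using carrQ assms by simp
  also have "\<dots> = jacobi_coeff m 0"
    unfolding c_eq[symmetric] using assms by (simp add: c_def)
  finally have "Q $$ (0, 0) = jacobi_coeff m 0" .
  moreover have "real m = 2 * real N - 1"
    using assms by (simp add: m_def of_nat_diff)
  ultimately show "Q $$ (0, 0) = 2 * real N * (2 * real N + 1)"
    by (simp add: jacobi_coeff_0)
qed

end
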